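(* Let $G$ be a finite simple bipartite graph of order $2n$ with $n\geq 2$. Then $f(G)=n-2$ if and only if $G$ belongs to $\mathcal{G}_1$ or to $\mathcal{G}_2$.
   Context: For a graph $G$ with a perfect matching $M$, a subset $S\subseteq M$ is a forcing set of $M$ if $S$ is contained in no perfect matching of $G$ other than $M$; $f(G,M)$ is the minimum size of a forcing set of $M$, and $f(G)=\min_M f(G,M)$ over perfect matchings $M$ (so $f(G)=n-2$ presupposes that $G$ has a perfect matching). $\mathcal{G}_1$ is the set of graphs obtained from $K_{n,n}$ with parts $U,V$ ($|U|=|V|=n$) by deleting all edges of $t\geq 1$ pairwise vertex-disjoint complete bipartite subgraphs with parts $A_i\subseteq U$, $B_i\subseteq V$, $A_i,B_i\neq\emptyset$, each of order $|A_i|+|B_i|\leq n$ (so the result is not $K_{n,n}$). $\mathcal{G}_2$ is the set of bipartite graphs of order $2n$ whose vertex set is the disjoint union of the vertex sets of two complete bipartite graphs $K_{a,a}$ and $K_{b,b}$ ($a,b\ge1$, $a+b=n$), containing both as subgraphs, such that every other edge of $G$ joins these two subgraphs and is forbidden, i.e. lies in no perfect matching of $G$. *)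

theory Defs
  imports Main "HOL-Library.Disjoint_Sets"
begin

text \<open>A graph is given by its vertex set \<open>V\<close> and its set \<open>E\<close> of edges, an edge being the
  unordered pair of its two ends.\<close>

definition finite_simple_graph :: "'a set \<Rightarrow> 'a set set \<Rightarrow> bool" where
  "finite_simple_graph V E \<longleftrightarrow> finite V \<and> (\<forall>e\<in>E. e \<subseteq> V \<and> card e = 2)"

definition biclique_edges :: "'a set \<Rightarrow> 'a set \<Rightarrow> 'a set set" where
  "biclique_edges X Y = {{x, y} | x y. x \<in> X \<and> y \<in> Y}"

definition bipartite_graph :: "'a set \<Rightarrow> 'a set set \<Rightarrow> bool" where
  "bipartite_graph V E \<longleftrightarrow>
     finite_simple_graph V E \<and>
     (\<exists>X Y. X \<union> Y = V \<and> X \<inter> Y = {} \<and> (\<forall>e\<in>E. \<exists>x\<in>X. \<exists>y\<in>Y. e = {x, y}))"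

definition perfect_matching :: "'a set \<Rightarrow> 'a set set \<Rightarrow> 'a set set \<Rightarrow> bool" where
  "perfect_matching V E M \<longleftrightarrow> M \<subseteq> E \<and> disjoint M \<and> \<Union>M = V"

definition forcing_set :: "'a set \<Rightarrow> 'a set set \<Rightarrow> 'a set set \<Rightarrow> 'a set set \<Rightarrow> bool" where
  "forcing_set V E M S \<longleftrightarrow>
     S \<subseteq> M \<and> (\<forall>M'. perfect_matching V E M' \<and> S \<subseteq> M' \<longrightarrow> M' = M)"

definition matching_forcing_number :: "'a set \<Rightarrow> 'a set set \<Rightarrow> 'a set set \<Rightarrow> nat" where
  "matching_forcing_number V E M = (LEAST k. \<exists>S. forcing_set V E M S \<and> card S = k)"

text \<open>Only meaningful for graphs that have a perfect matching; otherwise the value is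
  unspecified.\<close>

definition forcing_number :: "'a set \<Rightarrow> 'a set set \<Rightarrow> nat" where
  "forcing_number V E =
     (LEAST k. \<exists>M. perfect_matching V E M \<and> matching_forcing_number V E M = k)"

definition forbidden_edge :: "'a set \<Rightarrow> 'a set set \<Rightarrow> 'a set \<Rightarrow> bool" where
  "forbidden_edge V E e \<longleftrightarrow> e \<in> E \<and> \<not> (\<exists>M. perfect_matching V E M \<and> e \<in> M)"

text \<open>The two classes below consist of the members of order \<open>2 * n\<close>. Since the parts are arbitrary
  subsets of the vertex type, both classes are closed under isomorphism.\<close>

definition G1 :: "nat \<Rightarrow> ('a set \<times> 'a set set) set" where
  "G1 n = {(V, E). \<exists>X Y (t::nat) A B.
     finite X \<and> finite Y \<and> X \<inter> Y = {} \<and> card X = n \<and> card Y = n \<and> 1 \<le> t \<and>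
     (\<forall>i<t. A i \<subseteq> X \<and> A i \<noteq> {} \<and> B i \<subseteq> Y \<and> B i \<noteq> {} \<and> card (A i) + card (B i) \<le> n) \<and>
     disjoint_family_on (\<lambda>i. A i \<union> B i) {..<t} \<and>
     V = X \<union> Y \<and>
     E = biclique_edges X Y - (\<Union>i<t. biclique_edges (A i) (B i))}"

definition G2 :: "nat \<Rightarrow> ('a set \<times> 'a set set) set" where
  "G2 n = {(V, E). bipartite_graph V E \<and> card V = 2 * n \<and>
     (\<exists>a b X1 Y1 X2 Y2.
        1 \<le> a \<and> 1 \<le> b \<and> a + b = n \<and>
        card X1 = a \<and> card Y1 = a \<and> card X2 = b \<and> card Y2 = b \<and>
        X1 \<inter> Y1 = {} \<and> X2 \<inter> Y2 = {} \<and> (X1 \<union> Y1) \<inter> (X2 \<union> Y2) = {} \<and>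
        V = (X1 \<union> Y1) \<union> (X2 \<union> Y2) \<and>
        biclique_edges X1 Y1 \<subseteq> E \<and> biclique_edges X2 Y2 \<subseteq> E \<and>
        (\<forall>e \<in> E - (biclique_edges X1 Y1 \<union> biclique_edges X2 Y2).
           (\<exists>x \<in> X1 \<union> Y1. \<exists>y \<in> X2 \<union> Y2. e = {x, y}) \<and> forbidden_edge V E e))}"

end

theory Submission
  imports Defs "HOL-Combinatorics.Permutations"
begin

text \<open>Perfect matchings are bijections \<open>p\<close> between the two sides, and \<open>{a, p b} \<in> E\<close> is read as an
  arc from \<open>a\<close> to \<open>b\<close>. A set of matching edges is forcing iff its complement spans no directed
  cycle, so \<open>f(G) = n - 2\<close> means that no perfect matching has three vertices spanning an acyclic
  subdigraph and that some edge is missing. If \<open>x y\<close>, \<open>x y'\<close>, \<open>x' y\<close> are missing, then a perfect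
  matching through an edge \<open>x' y'\<close> would contain an acyclic triple. Hence either every edge lies in
  a perfect matching and the missing edges form disjoint bicliques, or there is a forbidden edge,
  and it splits the digraph into two complete parts.\<close>

section \<open>Forcing numbers as attained minima\<close>

text \<open>Perfect matchings are inclusion-maximal: an edge of \<open>M'\<close> has an end,
  \<open>M\<close> covers that end by an edge that also lies in \<open>M'\<close>, and disjointness
  of \<open>M'\<close> makes the two edges equal. In particular a perfect matching forces
  itself.\<close>

lemma perfect_matching_subset_eq:
  assumes "finite_simple_graph V E" "perfect_matching V E M" "perfect_matching V E M'" "M \<subseteq> M'"
  shows "M' = M"
proof -
  have "e \<in> M" if e: "e \<in> M'" for e
  proof -
    have "e \<in> E" using e assms(3) unfolding perfect_matching_def by blast
    then have "card e = 2" "e \<subseteq> V" using assms(1) unfolding finite_simple_graph_def by auto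
    then obtain v where v: "v \<in> e" "v \<in> V" by (auto simp: card_2_iff)
    then obtain m where m: "m \<in> M" "v \<in> m" using assms(2) unfolding perfect_matching_def by blast
    then have "m \<in> M'" using assms(4) by blast
    then have "m = e" using assms(3) m e v disjointD[of M' m e] unfolding perfect_matching_def by blast
    then show ?thesis using m by simp
  qed
  then show ?thesis using assms(4) by blast
qed

text \<open>Both nested uses of \<open>LEAST\<close> are attained, the inner one because
  \<open>M\<close> is a forcing set of itself and the outer one by \<open>ex\<close>. So they merge
  into one minimum over pairs of a perfect matching and a forcing set of it.\<close>

lemma forcing_number_eq_iff:
  assumes "finite_simple_graph V E" and ex: "\<exists>M. perfect_matching V E M"
  shows "forcing_number V E = k \<longleftrightarrow>
    (\<exists>M S. perfect_matching V E M \<and> forcing_set V E M S \<and> card S = k) \<and>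
    (\<forall>M S. perfect_matching V E M \<and> forcing_set V E M S \<longrightarrow> k \<le> card S)"
proof -
  let ?f = "matching_forcing_number V E"
  have le: "?f M \<le> card S" if "forcing_set V E M S" for M S
    unfolding matching_forcing_number_def using that by (auto intro: Least_le)
  have at: "\<exists>S. forcing_set V E M S \<and> card S = ?f M" if "perfect_matching V E M" for M
  proof -
    have "forcing_set V E M M"
      unfolding forcing_set_def using perfect_matching_subset_eq[OF assms(1) that] by blast
    then have "\<exists>k S. forcing_set V E M S \<and> card S = k" by blast
    then show ?thesis
      unfolding matching_forcing_number_def by (rule LeastI_ex[of "\<lambda>k. \<exists>S. forcing_set V E M S \<and> card S = k"])
  qed
  have le': "forcing_number V E \<le> ?f M" if "perfect_matching V E M" for M
    unfolding forcing_number_def using that by (auto intro: Least_le)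
  have at': "\<exists>M. perfect_matching V E M \<and> ?f M = forcing_number V E"
    unfolding forcing_number_def
    by (rule LeastI_ex[of "\<lambda>k. \<exists>M. perfect_matching V E M \<and> ?f M = k"]) (use ex in blast)
  then obtain M where M: "perfect_matching V E M" "?f M = forcing_number V E" by blast
  from at[OF M(1)] obtain S where S: "forcing_set V E M S" "card S = ?f M" by blast
  have lb: "forcing_number V E \<le> card S'" if "perfect_matching V E M'" "forcing_set V E M' S'" for M' S'
    using le'[OF that(1)] le[OF that(2)] by linarith
  show ?thesis
  proof
    assume "forcing_number V E = k"
    then show "(\<exists>M S. perfect_matching V E M \<and> forcing_set V E M S \<and> card S = k) \<and>
      (\<forall>M S. perfect_matching V E M \<and> forcing_set V E M S \<longrightarrow> k \<le> card S)"
      using M S lb by metis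
  next
    assume "(\<exists>M S. perfect_matching V E M \<and> forcing_set V E M S \<and> card S = k) \<and>
      (\<forall>M S. perfect_matching V E M \<and> forcing_set V E M S \<longrightarrow> k \<le> card S)"
    then show "forcing_number V E = k"
      using M S lb by (metis le_antisym)
  qed
qed

lemma biclique_edges_commute: "biclique_edges X Y = biclique_edges Y X"
  unfolding biclique_edges_def by blast

lemma three_distinct_in_set:
  assumes "3 \<le> card T"
  obtains a b c where "a \<in> T" "b \<in> T" "c \<in> T" "a \<noteq> b" "a \<noteq> c" "b \<noteq> c"
proof -
  obtain T' where "T' \<subseteq> T" "card T' = 3" using obtain_subset_with_card_n[OF assms] by blast
  then show ?thesis using that by (auto simp: card_3_iff)
qed

lemma two_distinct_in_set:
  assumes "2 \<le> card T"
  obtains a b where "a \<in> T" "b \<in> T" "a \<noteq> b"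
proof -
  obtain T' where "T' \<subseteq> T" "card T' = 2" using obtain_subset_with_card_n[OF assms] by blast
  then show ?thesis using that by (auto simp: card_2_iff)
qed

section \<open>Perfect matchings as bijections between fixed sides\<close>

text \<open>The two sides are fixed once so that edges can be read as ordered pairs. They may differ
  in size; equal cardinality is derived only from a matching map.\<close>

locale bipartition =
  fixes X Y :: "'a set" and E :: "'a set set"
  assumes finite_X: "finite X" and finite_Y: "finite Y" and disjoint_XY: "X \<inter> Y = {}"
    and edges_subset: "E \<subseteq> biclique_edges X Y"
begin

definition matching_map :: "('a \<Rightarrow> 'a) \<Rightarrow> bool" where
  "matching_map p \<longleftrightarrow> bij_betw p X Y \<and> (\<forall>x\<in>X. {x, p x} \<in> E)"

definition matching_of :: "('a \<Rightarrow> 'a) \<Rightarrow> 'a set set" where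
  "matching_of p = (\<lambda>x. {x, p x}) ` X"

lemma edge_eq_iff:
  assumes "x \<in> X" "x' \<in> X" "y \<in> Y" "y' \<in> Y"
  shows "{x, y} = {x', y'} \<longleftrightarrow> x = x' \<and> y = y'"
  using assms disjoint_XY by (auto simp: doubleton_eq_iff)

lemma edgeE:
  assumes "e \<in> E" obtains x y where "x \<in> X" "y \<in> Y" "e = {x, y}"
  using assms edges_subset unfolding biclique_edges_def by blast

lemma edge_card: "e \<in> E \<Longrightarrow> card e = 2"
  using disjoint_XY by (elim edgeE) (metis card_2_iff disjoint_iff)

lemma finite_simple_graph_XY: "finite_simple_graph (X \<union> Y) E"
  unfolding finite_simple_graph_def
  using edge_card finite_X finite_Y by (auto elim!: edgeE)

lemma matching_map_in: "matching_map p \<Longrightarrow> x \<in> X \<Longrightarrow> p x \<in> Y"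
  unfolding matching_map_def by (auto dest: bij_betwE)

lemma matching_map_eq_iff:
  "matching_map p \<Longrightarrow> x \<in> X \<Longrightarrow> x' \<in> X \<Longrightarrow> p x = p x' \<longleftrightarrow> x = x'"
  unfolding matching_map_def by (auto dest: bij_betw_imp_inj_on inj_onD)

lemma matching_map_edge: "matching_map p \<Longrightarrow> x \<in> X \<Longrightarrow> {x, p x} \<in> E"
  unfolding matching_map_def by blast

lemma matching_map_surj:
  assumes "matching_map p" "y \<in> Y" obtains x where "x \<in> X" "y = p x"
  using assms unfolding matching_map_def bij_betw_def by blast

lemma mem_matching_of_iff:
  assumes "matching_map p" "x \<in> X" "y \<in> Y"
  shows "{x, y} \<in> matching_of p \<longleftrightarrow> y = p x"
  unfolding matching_of_def using assms edge_eq_iff matching_map_in by (auto simp: image_iff)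

lemma perfect_matching_matching_of:
  assumes p: "matching_map p"
  shows "perfect_matching (X \<union> Y) E (matching_of p)"
proof -
  have "matching_of p \<subseteq> E" unfolding matching_of_def using matching_map_edge[OF p] by blast
  moreover have "disjoint (matching_of p)"
    unfolding matching_of_def disjoint_def
    using disjoint_XY matching_map_in[OF p] matching_map_eq_iff[OF p] by fastforce
  moreover have "\<Union>(matching_of p) = X \<union> Y"
    unfolding matching_of_def using p matching_map_in[OF p] by (auto elim: matching_map_surj[OF p])
  ultimately show ?thesis unfolding perfect_matching_def by blast
qed

text \<open>Covering gives each vertex of \<open>X\<close> a partner, and disjointness makes the
  partner unique and the choice injective. Covering of \<open>Y\<close> makes it surjective.\<close>

lemma perfect_matchingE:
  assumes M: "perfect_matching (X \<union> Y) E M"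
  obtains p where "matching_map p" "M = matching_of p"
proof -
  have ME: "M \<subseteq> E" and dis: "disjoint M" and un: "\<Union>M = X \<union> Y"
    using M unfolding perfect_matching_def by auto
  have uniq: "e = e'" if "e \<in> M" "e' \<in> M" "v \<in> e" "v \<in> e'" for e e' v
    using disjointD[OF dis that(1,2)] that by blast
  have exX: "\<exists>y\<in>Y. {x, y} \<in> M" if x: "x \<in> X" for x
  proof -
    obtain e where e: "e \<in> M" "x \<in> e" using x un by blast
    with ME obtain x' y where "x' \<in> X" "y \<in> Y" "e = {x', y}" by (blast elim: edgeE)
    then show ?thesis using e x disjoint_XY by auto
  qed
  have exY: "\<exists>x\<in>X. {x, y} \<in> M" if y: "y \<in> Y" for y
  proof -
    obtain e where e: "e \<in> M" "y \<in> e" using y un by blast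
    with ME obtain x y' where "x \<in> X" "y' \<in> Y" "e = {x, y'}" by (blast elim: edgeE)
    then show ?thesis using e y disjoint_XY by auto
  qed
  obtain p where p: "\<And>x. x \<in> X \<Longrightarrow> p x \<in> Y \<and> {x, p x} \<in> M" using exX by metis
  have inj: "inj_on p X"
  proof (rule inj_onI)
    fix x x' assume "x \<in> X" "x' \<in> X" "p x = p x'"
    then show "x = x'" using p[of x] p[of x'] uniq[of "{x, p x}" "{x', p x'}" "p x"] edge_eq_iff by auto
  qed
  have eq: "p x = y" if "x \<in> X" "y \<in> Y" "{x, y} \<in> M" for x y
    using p[of x] uniq[of "{x, p x}" "{x, y}" x] that edge_eq_iff by auto
  have "p ` X = Y" using p eq exY by (auto simp: image_iff) metis
  then have "matching_map p" unfolding matching_map_def bij_betw_def using inj p ME by blast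
  moreover have "M = matching_of p"
  proof
    show "matching_of p \<subseteq> M" unfolding matching_of_def using p by blast
    show "M \<subseteq> matching_of p"
    proof
      fix e assume e: "e \<in> M"
      with ME obtain x y where "x \<in> X" "y \<in> Y" "e = {x, y}" by (blast elim: edgeE)
      then show "e \<in> matching_of p" using eq e unfolding matching_of_def by blast
    qed
  qed
  ultimately show ?thesis using that by blast
qed

lemma ex_perfect_matching_iff: "(\<exists>M. perfect_matching (X \<union> Y) E M) \<longleftrightarrow> (\<exists>p. matching_map p)"
  using perfect_matchingE perfect_matching_matching_of by metis

lemma forbidden_edge_iff:
  assumes "x \<in> X" "y \<in> Y"
  shows "forbidden_edge (X \<union> Y) E {x, y} \<longleftrightarrow> {x, y} \<in> E \<and> \<not> (\<exists>p. matching_map p \<and> p x = y)"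
  unfolding forbidden_edge_def
  using assms perfect_matchingE perfect_matching_matching_of mem_matching_of_iff by metis

lemma matching_map_card: "matching_map p \<Longrightarrow> card X = card Y"
  unfolding matching_map_def by (auto dest: bij_betw_same_card)

section \<open>Rotating a matching along directed cycles\<close>

text \<open>Only the points moved by \<open>\<pi>\<close> need a new edge, so a directed cycle in
  the digraph of \<open>p\<close> is enough to change the matching. The composed transpositions
  below send \<open>a\<close> to \<open>b\<close>, \<open>b\<close> to \<open>c\<close> and so on,
  and the last vertex back to \<open>a\<close>.\<close>

lemma matching_map_permute:
  assumes "matching_map p" "\<pi> permutes X" "\<And>x. x \<in> X \<Longrightarrow> \<pi> x \<noteq> x \<Longrightarrow> {x, p (\<pi> x)} \<in> E"
  shows "matching_map (p \<circ> \<pi>)"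
proof -
  have "bij_betw (p \<circ> \<pi>) X Y"
    using assms(1) permutes_imp_bij[OF assms(2)] bij_betw_trans unfolding matching_map_def by blast
  moreover have "{x, p (\<pi> x)} \<in> E" if "x \<in> X" for x
    using assms(3)[OF that] matching_map_edge[OF assms(1) that] by (cases "\<pi> x = x") auto
  ultimately show ?thesis unfolding matching_map_def by simp
qed

lemma rotate2:
  assumes "matching_map p" "a \<in> X" "b \<in> X" "{a, p b} \<in> E" "{b, p a} \<in> E"
  shows "matching_map (p \<circ> transpose a b)"
  using assms by (intro matching_map_permute permutes_swap_id) (auto simp: transpose_def split: if_splits)

lemma rotate3:
  assumes "matching_map p" "a \<in> X" "b \<in> X" "c \<in> X" "distinct [a, b, c]"
    "{a, p b} \<in> E" "{b, p c} \<in> E" "{c, p a} \<in> E"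
  shows "matching_map (p \<circ> (transpose a b \<circ> transpose b c))"
  using assms by (intro matching_map_permute permutes_compose permutes_swap_id)
    (auto simp: transpose_def split: if_splits)

lemma rotate4:
  assumes "matching_map p" "a \<in> X" "b \<in> X" "c \<in> X" "d \<in> X" "distinct [a, b, c, d]"
    "{a, p b} \<in> E" "{b, p c} \<in> E" "{c, p d} \<in> E" "{d, p a} \<in> E"
  shows "matching_map (p \<circ> (transpose a b \<circ> (transpose b c \<circ> transpose c d)))"
  using assms by (intro matching_map_permute permutes_compose permutes_swap_id)
    (auto simp: transpose_def split: if_splits)

section \<open>Forcing sets and directed cycles\<close>

lemma card_matching_of_image:
  assumes p: "matching_map p" and "T \<subseteq> X"
  shows "card ((\<lambda>x. {x, p x}) ` T) = card T"
proof (rule card_image)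
  show "inj_on (\<lambda>x. {x, p x}) T"
    using assms edge_eq_iff matching_map_in[OF p] by (intro inj_onI) blast
qed

text \<open>The function \<open>r\<close> is a topological numbering of \<open>T\<close>: arcs
  inside \<open>T\<close> only lead to smaller values. Hence a matching that agrees with
  \<open>p\<close> outside \<open>T\<close> can be shown to agree on \<open>T\<close> by induction
  on \<open>r\<close>.\<close>

lemma forcing_set_of_acyclic:
  fixes r :: "'a \<Rightarrow> nat"
  assumes p: "matching_map p" and T: "T \<subseteq> X"
    and r: "inj_on r T"
    and acyclic: "\<And>a b. a \<in> T \<Longrightarrow> b \<in> T \<Longrightarrow> r a < r b \<Longrightarrow> {a, p b} \<notin> E"
  shows "forcing_set (X \<union> Y) E (matching_of p) ((\<lambda>x. {x, p x}) ` (X - T))"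
  unfolding forcing_set_def
proof (intro conjI allI impI)
  show "(\<lambda>x. {x, p x}) ` (X - T) \<subseteq> matching_of p" unfolding matching_of_def by blast
next
  fix M' assume M': "perfect_matching (X \<union> Y) E M' \<and> (\<lambda>x. {x, p x}) ` (X - T) \<subseteq> M'"
  then obtain q where q: "matching_map q" "M' = matching_of q" using perfect_matchingE by blast
  have out: "q x = p x" if "x \<in> X - T" for x
  proof -
    have "{x, p x} \<in> matching_of q" using M' that q by auto
    then show ?thesis using mem_matching_of_iff[OF q(1), of x "p x"] matching_map_in[OF p, of x] that by auto
  qed
  have eq: "a \<in> T \<longrightarrow> q a = p a" for a
  proof (induction "r a" arbitrary: a rule: less_induct)
    case less
    show ?case
    proof
      assume a: "a \<in> T"
      then have aX: "a \<in> X" using T by blast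
      \<comment> \<open>If \<open>q a\<close> differs from \<open>p a\<close>, there is an arc from
        \<open>a\<close> to another vertex \<open>b\<close>, and injectivity of \<open>q\<close>
        shows that \<open>b\<close> is moved as well. So \<open>b\<close> lies in \<open>T\<close>
        and, by the induction hypothesis, not below \<open>a\<close>; but no arc leads
        upwards.\<close>
      obtain b where b: "b \<in> X" "q a = p b"
        using matching_map_surj[OF p matching_map_in[OF q(1) aX]] by blast
      show "q a = p a"
      proof (rule ccontr)
        assume "q a \<noteq> p a"
        then have "a \<noteq> b" using b by auto
        have qb: "q b \<noteq> p b" using matching_map_eq_iff[OF q(1) aX b(1)] \<open>a \<noteq> b\<close> b by auto
        then have bT: "b \<in> T" using out b by blast
        then have "\<not> r b < r a" using less qb by blast
        moreover have "r a \<noteq> r b" using r a bT \<open>a \<noteq> b\<close> by (auto dest: inj_onD)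
        moreover have "{a, p b} \<in> E" using matching_map_edge[OF q(1) aX] b by simp
        ultimately show False using acyclic[OF a bT] by linarith
      qed
    qed
  qed
  have "q x = p x" if "x \<in> X" for x using eq out that by blast
  then show "M' = matching_of p" unfolding q matching_of_def by simp
qed

text \<open>This is the means of refuting a forcing set: a matching map different from
  \<open>p\<close> on \<open>X\<close> must give up an edge of \<open>S\<close>, so no rotation may
  leave all of \<open>S\<close> in place.\<close>

lemma forcing_set_moved:
  assumes p: "matching_map p" and S: "forcing_set (X \<union> Y) E (matching_of p) S"
    and q: "matching_map q" and x: "x \<in> X" "q x \<noteq> p x"
  obtains z where "z \<in> X" "q z \<noteq> p z" "{z, p z} \<in> S"
proof -
  have "matching_of q \<noteq> matching_of p"
    using mem_matching_of_iff[OF p x(1) matching_map_in[OF q x(1)]]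
      mem_matching_of_iff[OF q x(1) matching_map_in[OF q x(1)]] x by auto
  then have "\<not> S \<subseteq> matching_of q"
    using S perfect_matching_matching_of[OF q] unfolding forcing_set_def by blast
  then obtain e where e: "e \<in> S" "e \<notin> matching_of q" by blast
  then have "e \<in> matching_of p" using S unfolding forcing_set_def by blast
  then obtain z where z: "z \<in> X" "e = {z, p z}" unfolding matching_of_def by blast
  then have "q z \<noteq> p z" using e unfolding matching_of_def by auto
  then show ?thesis using that z e by blast
qed

lemma forcing_set_complement:
  assumes p: "matching_map p" and S: "forcing_set (X \<union> Y) E (matching_of p) S"
  obtains T where "T \<subseteq> X" "S = (\<lambda>x. {x, p x}) ` T" "card T = card S"
    "card (X - T) = card X - card S"
proof -
  have "S \<subseteq> (\<lambda>x. {x, p x}) ` X" using S unfolding forcing_set_def matching_of_def by blast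
  then obtain T where T: "T \<subseteq> X" "S = (\<lambda>x. {x, p x}) ` T" by (auto simp: subset_image_iff)
  then have "card T = card S" using card_matching_of_image[OF p] by simp
  then show ?thesis using that T card_Diff_subset[of T X] finite_subset[OF T(1) finite_X] by auto
qed

section \<open>Acyclic triples and the value n - 2\<close>

text \<open>The three listed edges are the arcs going forward in the order \<open>a\<close>,
  \<open>b\<close>, \<open>c\<close>. As all orders of a triple are quantified over, the condition
  says that no three vertices span an acyclic subdigraph.\<close>

definition acyclic_triple_free :: bool where
  "acyclic_triple_free \<longleftrightarrow> (\<forall>p. matching_map p \<longrightarrow> (\<forall>a\<in>X. \<forall>b\<in>X. \<forall>c\<in>X.
     distinct [a, b, c] \<longrightarrow> {a, p b} \<in> E \<or> {a, p c} \<in> E \<or> {b, p c} \<in> E))"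

lemma acyclic_triple_freeD:
  "acyclic_triple_free \<Longrightarrow> matching_map p \<Longrightarrow> a \<in> X \<Longrightarrow> b \<in> X \<Longrightarrow> c \<in> X \<Longrightarrow>
   a \<noteq> b \<Longrightarrow> a \<noteq> c \<Longrightarrow> b \<noteq> c \<Longrightarrow> {a, p b} \<in> E \<or> {a, p c} \<in> E \<or> {b, p c} \<in> E"
  unfolding acyclic_triple_free_def by simp

text \<open>Each of the six orders of the triple has a forward arc. These six clauses
  propositionally imply one of the three 2-cycles or one of the two 3-cycles.\<close>

lemma acyclic_triple_free_cycle:
  assumes atf: "acyclic_triple_free" and p: "matching_map p"
    and X: "a \<in> X" "b \<in> X" "c \<in> X" and d: "a \<noteq> b" "a \<noteq> c" "b \<noteq> c"
  shows "{a, p b} \<in> E \<and> {b, p a} \<in> E \<or> {a, p c} \<in> E \<and> {c, p a} \<in> E \<or> {b, p c} \<in> E \<and> {c, p b} \<in> E \<or>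
    {a, p b} \<in> E \<and> {b, p c} \<in> E \<and> {c, p a} \<in> E \<or> {a, p c} \<in> E \<and> {c, p b} \<in> E \<and> {b, p a} \<in> E"
proof -
  note tr = acyclic_triple_freeD[OF atf p]
  have "{a, p b} \<in> E \<or> {a, p c} \<in> E \<or> {b, p c} \<in> E" "{a, p c} \<in> E \<or> {a, p b} \<in> E \<or> {c, p b} \<in> E"
    "{b, p a} \<in> E \<or> {b, p c} \<in> E \<or> {a, p c} \<in> E" "{b, p c} \<in> E \<or> {b, p a} \<in> E \<or> {c, p a} \<in> E"
    "{c, p a} \<in> E \<or> {c, p b} \<in> E \<or> {a, p b} \<in> E" "{c, p b} \<in> E \<or> {c, p a} \<in> E \<or> {b, p a} \<in> E"
    using tr[of a b c] tr[of a c b] tr[of b a c] tr[of b c a] tr[of c a b] tr[of c b a] X d by auto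
  then show ?thesis by argo
qed

lemma edge_mem_image_iff:
  assumes "matching_map p" "T \<subseteq> X" "x \<in> X"
  shows "{x, p x} \<in> (\<lambda>x. {x, p x}) ` T \<longleftrightarrow> x \<in> T"
  using assms edge_eq_iff matching_map_in[OF assms(1)] by (auto simp: image_iff)

text \<open>A smaller forcing set would leave three vertices free. They span a directed cycle of
  length 2 or 3, and rotating along it gives another perfect matching that contains
  \<open>S\<close>.\<close>

lemma forcing_set_card_ge:
  assumes atf: "acyclic_triple_free" and p: "matching_map p"
    and S: "forcing_set (X \<union> Y) E (matching_of p) S"
  shows "card X - 2 \<le> card S"
proof (rule ccontr)
  assume neg: "\<not> ?thesis"
  obtain T where T: "T \<subseteq> X" "S = (\<lambda>x. {x, p x}) ` T" "card (X - T) = card X - card S"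
    using forcing_set_complement[OF p S] by blast
  have "3 \<le> card (X - T)" using neg T by linarith
  then obtain a b c where abc: "a \<in> X - T" "b \<in> X - T" "c \<in> X - T" "a \<noteq> b" "a \<noteq> c" "b \<noteq> c"
    using three_distinct_in_set by metis
  have stuck: False if q: "matching_map q" "x \<in> X" "q x \<noteq> p x"
    "\<And>z. z \<in> X \<Longrightarrow> z \<notin> {a, b, c} \<Longrightarrow> q z = p z" for q x
  proof -
    obtain z where z: "z \<in> X" "q z \<noteq> p z" "{z, p z} \<in> S"
      using forcing_set_moved[OF p S q(1-3)] by blast
    then have "z \<in> T" using edge_mem_image_iff[OF p T(1)] T by blast
    then show False using z q(4) abc by blast
  qed
  have two: False if xy: "x \<in> {a, b, c}" "y \<in> {a, b, c}" and "x \<noteq> y" "{x, p y} \<in> E" "{y, p x} \<in> E" for x y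
  proof (rule stuck[where x = x])
    show "matching_map (p \<circ> transpose x y)" using that abc by (intro rotate2[OF p]) auto
    show "x \<in> X" using that abc by auto
    show "(p \<circ> transpose x y) x \<noteq> p x" using that abc matching_map_eq_iff[OF p, of x y] by auto
    show "(p \<circ> transpose x y) z = p z" if "z \<notin> {a, b, c}" for z
      using that xy by (auto simp: transpose_def)
  qed
  have three: False if xyz: "x \<in> {a, b, c}" "y \<in> {a, b, c}" "z \<in> {a, b, c}" and "distinct [x, y, z]"
    "{x, p y} \<in> E" "{y, p z} \<in> E" "{z, p x} \<in> E" for x y z
  proof (rule stuck[where x = x])
    show "matching_map (p \<circ> (transpose x y \<circ> transpose y z))"
      using that abc by (intro rotate3[OF p]) auto
    show "x \<in> X" using that abc by auto
    show "(p \<circ> (transpose x y \<circ> transpose y z)) x \<noteq> p x"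
      using that abc matching_map_eq_iff[OF p, of x y] by auto
    show "(p \<circ> (transpose x y \<circ> transpose y z)) w = p w" if "w \<notin> {a, b, c}" for w
      using that xyz by (auto simp: transpose_def)
  qed
  show False
    using acyclic_triple_free_cycle[OF atf p, of a b c] abc
      two[of a b] two[of a c] two[of b c] three[of a b c] three[of a c b] by auto
qed

lemma forcing_set_card_of_acyclic:
  fixes r :: "'a \<Rightarrow> nat"
  assumes p: "matching_map p" and T: "T \<subseteq> X" and "inj_on r T"
    and "\<And>a b. a \<in> T \<Longrightarrow> b \<in> T \<Longrightarrow> r a < r b \<Longrightarrow> {a, p b} \<notin> E"
  shows "\<exists>S. forcing_set (X \<union> Y) E (matching_of p) S \<and> card S = card X - card T"
  using forcing_set_of_acyclic[OF assms] card_matching_of_image[OF p, of "X - T"]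
    card_Diff_subset[of T X] finite_subset[OF T finite_X] T by auto

text \<open>The missing edge accounts for the upper bound: it yields an acyclic pair and so a
  forcing set of size \<open>n - 2\<close>. Triple-freeness accounts for the lower bound.\<close>

lemma forcing_number_eq_iff_acyclic_triple_free:
  assumes p0: "matching_map p0" and n: "card X = n" "2 \<le> n"
  shows "forcing_number (X \<union> Y) E = n - 2 \<longleftrightarrow>
    acyclic_triple_free \<and> (\<exists>x\<in>X. \<exists>y\<in>Y. {x, y} \<notin> E)"
proof -
  have "\<exists>M. perfect_matching (X \<union> Y) E M" using p0 ex_perfect_matching_iff by blast
  note iff = forcing_number_eq_iff[OF finite_simple_graph_XY this]
  show ?thesis
  proof
    assume "forcing_number (X \<union> Y) E = n - 2"
    then obtain M S where MS: "perfect_matching (X \<union> Y) E M" "forcing_set (X \<union> Y) E M S" "card S = n - 2"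
      and lb: "\<And>M S. perfect_matching (X \<union> Y) E M \<Longrightarrow> forcing_set (X \<union> Y) E M S \<Longrightarrow> n - 2 \<le> card S"
      using iff by blast
    obtain p where p: "matching_map p" "M = matching_of p" using perfect_matchingE[OF MS(1)] by blast
    have S: "forcing_set (X \<union> Y) E (matching_of p) S" using MS p by simp
    obtain T where T: "T \<subseteq> X" "S = (\<lambda>x. {x, p x}) ` T" "card (X - T) = card X - card S"
      using forcing_set_complement[OF p(1) S] by blast
    have "2 \<le> card (X - T)" using T MS n by linarith
    then obtain a b where ab: "a \<in> X - T" "b \<in> X - T" "a \<noteq> b" using two_distinct_in_set by metis
    \<comment> \<open>The vertices \<open>a\<close> and \<open>b\<close> are not covered by the
      forcing set, so a 2-cycle on them could be rotated.\<close>
    have "\<not> ({a, p b} \<in> E \<and> {b, p a} \<in> E)"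
    proof
      assume ed: "{a, p b} \<in> E \<and> {b, p a} \<in> E"
      have q: "matching_map (p \<circ> transpose a b)" using rotate2[OF p(1)] ed ab by auto
      have "(p \<circ> transpose a b) a \<noteq> p a" using matching_map_eq_iff[OF p(1), of a b] ab by auto
      then obtain z where z: "z \<in> X" "(p \<circ> transpose a b) z \<noteq> p z" "{z, p z} \<in> S"
        using forcing_set_moved[OF p(1) S q] ab by blast
      have "z \<in> T" using edge_mem_image_iff[OF p(1) T(1) z(1)] z T by blast
      then have "transpose a b z = z" using ab by (auto simp: transpose_def)
      then show False using z by simp
    qed
    then have "\<exists>x\<in>X. \<exists>y\<in>Y. {x, y} \<notin> E" using ab matching_map_in[OF p(1)] by blast
    moreover have "acyclic_triple_free"
      unfolding acyclic_triple_free_def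
    proof (intro allI impI ballI, rule ccontr)
      fix q a b c
      assume q: "matching_map q" and X: "a \<in> X" "b \<in> X" "c \<in> X" and d: "distinct [a, b, c]"
        and no: "\<not> ({a, q b} \<in> E \<or> {a, q c} \<in> E \<or> {b, q c} \<in> E)"
      define r :: "'a \<Rightarrow> nat" where "r = (\<lambda>x. if x = a then 0 else if x = b then 1 else 2)"
      have "\<exists>S. forcing_set (X \<union> Y) E (matching_of q) S \<and> card S = card X - card {a, b, c}"
        by (rule forcing_set_card_of_acyclic[OF q, where r = r])
          (use X d no in \<open>auto simp: r_def inj_on_def split: if_splits\<close>)
      then obtain S' where S': "forcing_set (X \<union> Y) E (matching_of q) S'" "card S' = n - 3"
        using d n by auto
      \<comment> \<open>The bound \<open>3 \<le> n\<close> is needed since truncated subtraction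
        makes \<open>n - 3\<close> and \<open>n - 2\<close> equal for \<open>n = 2\<close>.\<close>
      have "card {a, b, c} \<le> card X" using X finite_X by (intro card_mono) auto
      then have "3 \<le> n" using d n by auto
      then show False using lb[OF perfect_matching_matching_of[OF q] S'(1)] S'(2) by linarith
    qed
    ultimately show "acyclic_triple_free \<and> (\<exists>x\<in>X. \<exists>y\<in>Y. {x, y} \<notin> E)" by blast
  next
    assume R: "acyclic_triple_free \<and> (\<exists>x\<in>X. \<exists>y\<in>Y. {x, y} \<notin> E)"
    then obtain a y where ay: "a \<in> X" "y \<in> Y" "{a, y} \<notin> E" by blast
    obtain b where b: "b \<in> X" "y = p0 b" using matching_map_surj[OF p0 ay(2)] by blast
    have ne: "a \<noteq> b" using ay b matching_map_edge[OF p0] by auto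
    \<comment> \<open>Ranking \<open>a\<close> below \<open>b\<close> leaves
      \<open>{a, p0 b}\<close>, the given non-edge, as the only forward pair.\<close>
    define r :: "'a \<Rightarrow> nat" where "r = (\<lambda>x. if x = a then 0 else 1)"
    have "\<exists>S. forcing_set (X \<union> Y) E (matching_of p0) S \<and> card S = card X - card {a, b}"
      by (rule forcing_set_card_of_acyclic[OF p0, where r = r])
        (use ay b ne in \<open>auto simp: r_def inj_on_def split: if_splits\<close>)
    then have "\<exists>M S. perfect_matching (X \<union> Y) E M \<and> forcing_set (X \<union> Y) E M S \<and> card S = n - 2"
      using perfect_matching_matching_of[OF p0] ne n by (auto simp: numeral_2_eq_2)
    moreover have "n - 2 \<le> card S" if "perfect_matching (X \<union> Y) E M" "forcing_set (X \<union> Y) E M S" for M S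
      using that forcing_set_card_ge R n by (metis perfect_matchingE)
    ultimately show "forcing_number (X \<union> Y) E = n - 2" using iff by blast
  qed
qed

section \<open>From triple-freeness to the two classes\<close>

text \<open>With \<open>y = p w\<close>, the triple \<open>x\<close>, \<open>x'\<close>,
  \<open>w\<close> would have no forward arc. The lemma serves to complete three non-edges of a
  rectangle to four whenever the fourth pair, if an edge, lies in a perfect matching.\<close>

lemma acyclic_triple_free_forbidden:
  assumes atf: "acyclic_triple_free" and p: "matching_map p"
    and "x \<in> X" "x' \<in> X" "y \<in> Y" "{x, y} \<notin> E" "{x, p x'} \<notin> E"
  shows "{x', y} \<in> E"
proof (rule ccontr)
  assume no: "{x', y} \<notin> E"
  obtain w where w: "w \<in> X" "y = p w" using matching_map_surj[OF p \<open>y \<in> Y\<close>] by blast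
  have "x \<noteq> w" "x' \<noteq> w" "x \<noteq> x'" using w no assms matching_map_edge[OF p] by auto
  then show False using acyclic_triple_freeD[OF atf p, of x x' w] w no assms by auto
qed

text \<open>By \<open>closed\<close>, the sets of non-neighbours of two vertices of \<open>X\<close>
  are equal or disjoint. The distinct nonempty ones serve as the \<open>B i\<close>, and
  \<open>A i\<close> collects the vertices whose set of non-neighbours is
  \<open>B i\<close>.\<close>

lemma mem_G1I:
  assumes p: "matching_map p" and n: "card X = n"
    and nonedge: "\<exists>x\<in>X. \<exists>y\<in>Y. {x, y} \<notin> E"
    and closed: "\<And>x x' y y'. x \<in> X \<Longrightarrow> x' \<in> X \<Longrightarrow> y \<in> Y \<Longrightarrow> y' \<in> Y \<Longrightarrow>
      {x, y} \<notin> E \<Longrightarrow> {x, y'} \<notin> E \<Longrightarrow> {x', y} \<notin> E \<Longrightarrow> {x', y'} \<notin> E"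
  shows "(X \<union> Y, E) \<in> G1 n"
proof -
  define N where "N x = {y \<in> Y. {x, y} \<notin> E}" for x
  define F where "F = N ` X - {{}}"
  have finF: "finite F" unfolding F_def using finite_X by simp
  obtain B where B: "bij_betw B {..<card F} F"
    using ex_bij_betw_nat_finite[OF finF] by (auto simp: atLeast0LessThan)
  define A where "A i = {x \<in> X. N x = B i}" for i
  have BF: "B i \<in> F" if "i < card F" for i using B that by (auto dest: bij_betwE)
  have "F \<noteq> {}" unfolding F_def N_def using nonedge by blast
  then have t: "1 \<le> card F" using finF by (simp add: Suc_leI card_gt_0_iff)
  have non: "{x, y} \<notin> E" if "x \<in> A i" "y \<in> B i" for i x y
    using that unfolding A_def N_def by auto
  have AB: "A i \<subseteq> X" "A i \<noteq> {}" "B i \<subseteq> Y" "B i \<noteq> {}" "card (A i) + card (B i) \<le> n" if "i < card F" for i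
  proof -
    show AX: "A i \<subseteq> X" unfolding A_def by blast
    show "A i \<noteq> {}" "B i \<noteq> {}" using BF[OF that] unfolding F_def A_def by auto
    show BY: "B i \<subseteq> Y" using BF[OF that] unfolding F_def N_def by auto
    \<comment> \<open>The size bound comes from the matching: \<open>p\<close> embeds
      \<open>A i\<close> into \<open>Y\<close> and avoids \<open>B i\<close>, because no edge joins
      \<open>A i\<close> to \<open>B i\<close>.\<close>
    have "p ` A i \<subseteq> Y" using AX matching_map_in[OF p] by blast
    moreover have "p ` A i \<inter> B i = {}" using non matching_map_edge[OF p] AX by blast
    moreover have "card (p ` A i) = card (A i)"
      using AX matching_map_eq_iff[OF p] by (intro card_image inj_onI) blast
    ultimately have "card (A i) + card (B i) = card (p ` A i \<union> B i)"
      using BY finite_Y by (metis card_Un_disjoint finite_subset)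
    also have "\<dots> \<le> card Y" using BY \<open>p ` A i \<subseteq> Y\<close> finite_Y by (intro card_mono) auto
    finally show "card (A i) + card (B i) \<le> n" using matching_map_card[OF p] n by simp
  qed
  have Neq: "N x = N x'" if "x \<in> X" "x' \<in> X" "y \<in> N x" "y \<in> N x'" for x x' y
    using closed[OF that(1,2), of y] closed[OF that(2,1), of y] that unfolding N_def by blast
  have "disjoint_family_on (\<lambda>i. A i \<union> B i) {..<card F}"
    unfolding disjoint_family_on_def
  proof (intro ballI impI)
    fix i j assume ij: "i \<in> {..<card F}" "j \<in> {..<card F}" "i \<noteq> j"
    then have ne: "B i \<noteq> B j" using B by (auto dest: bij_betw_imp_inj_on inj_onD)
    have "A i \<inter> A j = {}" using ne unfolding A_def by auto
    moreover have "B i \<inter> B j = {}"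
    proof (rule ccontr)
      assume "B i \<inter> B j \<noteq> {}"
      then obtain y where y: "y \<in> B i" "y \<in> B j" by blast
      obtain x x' where "x \<in> X" "x' \<in> X" "B i = N x" "B j = N x'"
        using BF[of i] BF[of j] ij unfolding F_def by auto
      then show False using Neq[of x x' y] y ne by simp
    qed
    moreover have "A i \<inter> B j = {}" "B i \<inter> A j = {}"
      using AB[of i] AB[of j] ij disjoint_XY by blast+
    ultimately show "(A i \<union> B i) \<inter> (A j \<union> B j) = {}" by blast
  qed
  moreover have "E = biclique_edges X Y - (\<Union>i<card F. biclique_edges (A i) (B i))"
  proof
    show "E \<subseteq> biclique_edges X Y - (\<Union>i<card F. biclique_edges (A i) (B i))"
      using edges_subset non unfolding biclique_edges_def by blast
    show "biclique_edges X Y - (\<Union>i<card F. biclique_edges (A i) (B i)) \<subseteq> E"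
    proof
      fix e assume e: "e \<in> biclique_edges X Y - (\<Union>i<card F. biclique_edges (A i) (B i))"
      then obtain x y where xy: "x \<in> X" "y \<in> Y" "e = {x, y}" unfolding biclique_edges_def by blast
      show "e \<in> E"
      proof (rule ccontr)
        assume "e \<notin> E"
        then have y: "y \<in> N x" using xy unfolding N_def by auto
        then have "N x \<in> F" unfolding F_def using xy by auto
        then obtain i where "i < card F" "N x = B i" using B unfolding bij_betw_def by auto
        then have "x \<in> A i" "y \<in> B i" using y xy unfolding A_def by auto
        then show False using e xy \<open>i < card F\<close> unfolding biclique_edges_def by blast
      qed
    qed
  qed
  ultimately show ?thesis
    unfolding G1_def mem_Collect_eq case_prod_conv
    using t AB finite_X finite_Y disjoint_XY n matching_map_card[OF p]
    by (intro exI[of _ X] exI[of _ Y] exI[of _ "card F"] exI[of _ A] exI[of _ B]) simp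
qed

lemma bipartite_graph_XY: "bipartite_graph (X \<union> Y) E"
proof -
  have "\<forall>e\<in>E. \<exists>x\<in>X. \<exists>y\<in>Y. e = {x, y}" using edges_subset unfolding biclique_edges_def by blast
  then show ?thesis unfolding bipartite_graph_def using finite_simple_graph_XY disjoint_XY by metis
qed

text \<open>For a fixed perfect matching \<open>p\<close>, read \<open>{k, p l} \<in> E\<close> as an arc from \<open>k\<close> to \<open>l\<close>. The
  forbidden edge is an arc from \<open>i\<close> to \<open>j\<close> on no cycle of length 2, 3 or 4. With every further
  vertex it must span a cycle, so that vertex is joined in both directions to \<open>i\<close> or to \<open>j\<close>.\<close>

lemma mem_G2I:
  assumes atf: "acyclic_triple_free" and p: "matching_map p" and n: "card X = n"
    and x: "x \<in> X" and y: "y \<in> Y" and edge: "{x, y} \<in> E"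
    and forbidden: "\<And>q. matching_map q \<Longrightarrow> q x \<noteq> y"
  shows "(X \<union> Y, E) \<in> G2 n"
proof -
  define i where "i = x"
  obtain j where j: "j \<in> X" "y = p j" using matching_map_surj[OF p y] by blast
  have i: "i \<in> X" and ij: "i \<noteq> j" "{i, p j} \<in> E" using x j edge forbidden[OF p] unfolding i_def by auto
  have forb: "q i \<noteq> p j" if "matching_map q" for q using forbidden[OF that] j i_def by simp
  have no2: "{j, p i} \<notin> E"
    using rotate2[OF p i j(1) ij(2)] forb[of "p \<circ> transpose i j"] by auto
  have no3: False if "k \<in> X" "{j, p k} \<in> E" "{k, p i} \<in> E" for k
  proof -
    have k: "k \<noteq> i" "k \<noteq> j" using that no2 by auto
    then have "matching_map (p \<circ> (transpose i j \<circ> transpose j k))"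
      using rotate3[OF p i j(1) that(1)] that ij by auto
    from forb[OF this] show False using k ij by (auto simp: transpose_def)
  qed
  have no4: False if "k \<in> X" "l \<in> X" "{j, p k} \<in> E" "{k, p l} \<in> E" "{l, p i} \<in> E" for k l
  proof -
    have k: "k \<noteq> i" "l \<noteq> j" using that no2 by auto
    \<comment> \<open>If vertices of the closed walk \<open>i\<close>, \<open>j\<close>,
      \<open>k\<close>, \<open>l\<close> coincide, it shortens to a 3-cycle through the arc from
      \<open>i\<close> to \<open>j\<close>, which \<open>no3\<close> excludes.\<close>
    show False
    proof (cases "k = j \<or> l = i \<or> k = l")
      case True
      then show False using no3[of k] no3[of l] that by auto
    next
      case False
      then have "matching_map (p \<circ> (transpose i j \<circ> (transpose j k \<circ> transpose k l)))"
        using rotate4[OF p i j(1) that(1,2)] that ij k by auto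
      from forb[OF this] show False using k False ij by (auto simp: transpose_def)
    qed
  qed
  define A where "A = {k \<in> X. {i, p k} \<in> E \<and> {k, p i} \<in> E}"
  define B where "B = {k \<in> X. {j, p k} \<in> E \<and> {k, p j} \<in> E}"
  have AX: "A \<subseteq> X" and BX: "B \<subseteq> X" unfolding A_def B_def by auto
  have iA: "i \<in> A" and jB: "j \<in> B" using i j matching_map_edge[OF p] unfolding A_def B_def by auto
  have dis: "A \<inter> B = {}" using no3 unfolding A_def B_def by blast
  have cover: "A \<union> B = X"
  proof
    show "X \<subseteq> A \<union> B"
    proof
      fix k assume k: "k \<in> X"
      show "k \<in> A \<union> B"
      proof (cases "k = i \<or> k = j")
        case True then show ?thesis using iA jB by auto
      next
        case False
        \<comment> \<open>Among the five possible cycles on \<open>i\<close>, \<open>j\<close>,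
          \<open>k\<close>, those using an arc from \<open>j\<close> to \<open>i\<close> fall to
          \<open>no2\<close> and the 3-cycle through \<open>i\<close>, \<open>j\<close>,
          \<open>k\<close> in this order falls to \<open>no3\<close>. A 2-cycle between
          \<open>k\<close> and \<open>i\<close> or \<open>j\<close> remains.\<close>
        then show ?thesis
          using acyclic_triple_free_cycle[OF atf p i j(1) k] ij no2 no3[OF k] k
          unfolding A_def B_def by blast
      qed
    qed
  qed (use AX BX in blast)
  \<comment> \<open>No arc leads from \<open>j\<close> into \<open>A\<close>, so the cycle spanned
    by \<open>k\<close>, \<open>l\<close>, \<open>j\<close> avoids \<open>j\<close> and must be the
    2-cycle on \<open>k\<close> and \<open>l\<close>. In \<open>cliqueB\<close> the vertex
    \<open>i\<close> plays the dual part, having no arc into it from \<open>B\<close>.\<close>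
  have cliqueA: "{k, p l} \<in> E" if "k \<in> A" "l \<in> A" for k l
  proof (cases "k = l")
    case True then show ?thesis using that AX matching_map_edge[OF p] by blast
  next
    case False
    have "{j, p k} \<notin> E" "{j, p l} \<notin> E" "k \<noteq> j" "l \<noteq> j"
      using that no3 dis jB unfolding A_def by blast+
    then show ?thesis
      using acyclic_triple_free_cycle[OF atf p _ _ j(1), of k l] False that AX by blast
  qed
  have cliqueB: "{k, p l} \<in> E" if "k \<in> B" "l \<in> B" for k l
  proof (cases "k = l")
    case True then show ?thesis using that BX matching_map_edge[OF p] by blast
  next
    case False
    have "{k, p i} \<notin> E" "{l, p i} \<notin> E" "k \<noteq> i" "l \<noteq> i"
      using that no3 dis iA unfolding B_def by blast+
    then show ?thesis
      using acyclic_triple_free_cycle[OF atf p _ _ i, of k l] False that BX by blast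
  qed
  have noBA: "{k, p l} \<notin> E" if "k \<in> B" "l \<in> A" for k l
    using no4[of k l] that unfolding A_def B_def by blast
  have pY: "p ` X = Y" and inj: "inj_on p X" using p unfolding matching_map_def bij_betw_def by auto
  have cards: "card (p ` A) = card A" "card (p ` B) = card B"
    using inj AX BX by (auto intro!: card_image intro: inj_on_subset)
  have finAB: "finite A" "finite B" using AX BX finite_X by (auto intro: finite_subset)
  have pAB: "p ` A \<inter> p ` B = {}" using inj_on_image_Int[OF inj AX BX] dis by simp
  have pAY: "p ` A \<subseteq> Y" "p ` B \<subseteq> Y" using pY AX BX by auto
  have V: "X \<union> Y = (A \<union> p ` A) \<union> (B \<union> p ` B)" using cover pY by auto
  have rest: "(\<exists>x \<in> A \<union> p ` A. \<exists>y \<in> B \<union> p ` B. e = {x, y}) \<and> forbidden_edge (X \<union> Y) E e"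
    if e: "e \<in> E - (biclique_edges A (p ` A) \<union> biclique_edges B (p ` B))" for e
  proof -
    have eE: "e \<in> E" using e by blast
    obtain k y' where ky: "k \<in> X" "y' \<in> Y" "e = {k, y'}" using edgeE[OF eE] by blast
    obtain l where l: "l \<in> X" "y' = p l" using matching_map_surj[OF p ky(2)] by blast
    have "\<not> (k \<in> A \<and> l \<in> A)" "\<not> (k \<in> B \<and> l \<in> B)" "\<not> (k \<in> B \<and> l \<in> A)"
      using e ky l noBA[of k l] unfolding biclique_edges_def by blast+
    then have kl: "k \<in> A" "l \<in> B" using ky l cover by blast+
    \<comment> \<open>Without arcs from \<open>B\<close> to \<open>A\<close>, every matching map
      sends \<open>B\<close> into \<open>p\<close>
      B\<open>, and onto it by cardinality. Nothing in\<close>p \<open>B\<close> is left for a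
      vertex of \<open>A\<close>.\<close>
    have "q k \<noteq> p l" if q: "matching_map q" for q
    proof
      assume eq: "q k = p l"
      have "q ` B \<subseteq> p ` B"
      proof (rule image_subsetI)
        fix b assume b: "b \<in> B"
        then have bX: "b \<in> X" using BX by blast
        obtain c where c: "c \<in> X" "q b = p c"
          using matching_map_surj[OF p matching_map_in[OF q bX]] by blast
        then have "c \<notin> A" using noBA[OF b] matching_map_edge[OF q bX] by auto
        then show "q b \<in> p ` B" using c cover by auto
      qed
      moreover have "card (q ` B) = card (p ` B)"
        using cards(2) BX matching_map_eq_iff[OF q] by (subst card_image) (auto intro!: inj_onI)
      ultimately have "q ` B = p ` B" using finAB by (intro card_subset_eq) auto
      then obtain b where "b \<in> B" "q b = q k" using kl eq by (metis imageE imageI)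
      then show False using matching_map_eq_iff[OF q, of b k] BX ky kl dis by auto
    qed
    then have "forbidden_edge (X \<union> Y) E e"
      using forbidden_edge_iff[OF ky(1,2)] ky l eE by auto
    then show ?thesis using kl ky l by blast
  qed
  have pos: "1 \<le> card A" "1 \<le> card B" using iA jB finAB by (auto simp: Suc_le_eq card_gt_0_iff)
  have sum: "card A + card B = n" using card_Un_disjoint[OF finAB dis] cover n by simp
  have "biclique_edges A (p ` A) \<subseteq> E" "biclique_edges B (p ` B) \<subseteq> E"
    unfolding biclique_edges_def using cliqueA cliqueB by auto
  moreover have "A \<inter> p ` A = {}" "B \<inter> p ` B = {}" "(A \<union> p ` A) \<inter> (B \<union> p ` B) = {}"
    using AX BX pAY disjoint_XY dis pAB by blast+
  moreover have "card (X \<union> Y) = 2 * n"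
    using card_Un_disjoint[OF finite_X finite_Y disjoint_XY] matching_map_card[OF p] n by simp
  moreover have "\<forall>e \<in> E - (biclique_edges A (p ` A) \<union> biclique_edges B (p ` B)).
      (\<exists>x \<in> A \<union> p ` A. \<exists>y \<in> B \<union> p ` B. e = {x, y}) \<and> forbidden_edge (X \<union> Y) E e"
    using rest by (rule ballI)
  ultimately show ?thesis
    unfolding G2_def mem_Collect_eq case_prod_conv using bipartite_graph_XY pos sum cards V
    by (intro conjI exI[of _ "card A"] exI[of _ "card B"] exI[of _ A] exI[of _ "p ` A"]
        exI[of _ B] exI[of _ "p ` B"]) (assumption | rule refl)+
qed

section \<open>Both classes have a perfect matching, a non-edge and no acyclic triple\<close>

text \<open>A bijection with the fewest non-edges is a perfect matching: since \<open>card (A i) + card (B i)\<close>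
  is at most \<open>card X\<close>, a non-edge in \<open>A i \<times> B i\<close> can be exchanged with a pair avoiding both
  \<open>A i\<close> and \<open>B i\<close>, and both new pairs are edges.\<close>

lemma removed_bicliques:
  fixes t :: nat
  assumes n: "card X = n" "card Y = n" and t: "1 \<le> t"
    and AB: "\<And>i. i < t \<Longrightarrow> A i \<subseteq> X \<and> A i \<noteq> {} \<and> B i \<subseteq> Y \<and> B i \<noteq> {} \<and> card (A i) + card (B i) \<le> n"
    and dis: "disjoint_family_on (\<lambda>i. A i \<union> B i) {..<t}"
    and E: "E = biclique_edges X Y - (\<Union>i<t. biclique_edges (A i) (B i))"
  shows "\<exists>p. matching_map p" "\<exists>x\<in>X. \<exists>y\<in>Y. {x, y} \<notin> E" "acyclic_triple_free"
proof -
  have edge: "{x, y} \<in> E \<longleftrightarrow> \<not> (\<exists>i<t. x \<in> A i \<and> y \<in> B i)" if "x \<in> X" "y \<in> Y" for x y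
  proof -
    have "{x, y} \<in> biclique_edges X Y" using that unfolding biclique_edges_def by blast
    moreover have "{x, y} \<in> biclique_edges (A i) (B i) \<longleftrightarrow> x \<in> A i \<and> y \<in> B i" if i: "i < t" for i
    proof
      assume "{x, y} \<in> biclique_edges (A i) (B i)"
      then obtain x' y' where "x' \<in> A i" "y' \<in> B i" "{x, y} = {x', y'}"
        unfolding biclique_edges_def by blast
      then show "x \<in> A i \<and> y \<in> B i"
        using edge_eq_iff[of x x' y y'] AB[OF i] \<open>x \<in> X\<close> \<open>y \<in> Y\<close> by auto
    qed (auto simp: biclique_edges_def)
    ultimately show ?thesis unfolding E by auto
  qed
  have uniqA: "i = j" if "i < t" "j < t" "x \<in> A i" "x \<in> A j" for i j x
    using dis that unfolding disjoint_family_on_def by blast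
  have uniqB: "i = j" if "i < t" "j < t" "x \<in> B i" "x \<in> B j" for i j x
    using dis that unfolding disjoint_family_on_def by blast
  show "\<exists>x\<in>X. \<exists>y\<in>Y. {x, y} \<notin> E"
  proof -
    obtain x y where "x \<in> A 0" "y \<in> B 0" using AB[of 0] t by auto
    then show ?thesis using edge[of x y] AB[of 0] t by force
  qed
  show "acyclic_triple_free"
    unfolding acyclic_triple_free_def
  proof (intro allI impI ballI, rule ccontr)
    fix p a b c
    assume p: "matching_map p" and X: "a \<in> X" "b \<in> X" "c \<in> X"
      and no: "\<not> ({a, p b} \<in> E \<or> {a, p c} \<in> E \<or> {b, p c} \<in> E)"
    have Y: "p b \<in> Y" "p c \<in> Y" using matching_map_in[OF p] X by auto
    \<comment> \<open>The shared \<open>a\<close> gives \<open>i = j\<close> and the shared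
      \<open>p c\<close> gives \<open>j = k\<close>. Then \<open>b\<close> and \<open>p b\<close>
      lie in one removed biclique, although \<open>p\<close> matches them.\<close>
    obtain i j k where ijk: "i < t" "a \<in> A i" "p b \<in> B i" "j < t" "a \<in> A j" "p c \<in> B j"
      "k < t" "b \<in> A k" "p c \<in> B k"
      using no edge X Y by metis
    then have "i = k" using uniqA uniqB by metis
    then show False using matching_map_edge[OF p X(2)] edge[OF X(2) Y(1)] ijk by blast
  qed
  define bad where "bad p = {x \<in> X. {x, p x} \<notin> E}" for p
  have finbad: "finite (bad p)" for p unfolding bad_def using finite_X by simp
  have "\<exists>p. bij_betw p X Y" using finite_same_card_bij[OF finite_X finite_Y] n by simp
  then obtain p where p: "bij_betw p X Y" and least: "\<And>q. bij_betw q X Y \<Longrightarrow> card (bad p) \<le> card (bad q)"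
    using ex_has_least_nat[of "\<lambda>p. bij_betw p X Y" _ "\<lambda>p. card (bad p)"] by blast
  have pY: "p x \<in> Y" if "x \<in> X" for x using p that by (auto dest: bij_betwE)
  have "bad p = {}"
  proof (rule ccontr)
    assume "bad p \<noteq> {}"
    then obtain x where x: "x \<in> X" "{x, p x} \<notin> E" unfolding bad_def by blast
    then obtain i where i: "i < t" "x \<in> A i" "p x \<in> B i" using edge pY by blast
    \<comment> \<open>Since \<open>x\<close> lies in both \<open>A i\<close> and \<open>C\<close>,
      the union of these sets has fewer than \<open>n\<close> elements. This strictness supplies the
      exchange partner \<open>z\<close>.\<close>
    define C where "C = {z \<in> X. p z \<in> B i}"
    have fin: "finite (A i)" "finite C" using AB[OF i(1)] finite_X unfolding C_def by (auto intro: finite_subset)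
    have "p ` C = B i"
      using AB[OF i(1)] p unfolding C_def bij_betw_def by blast
    moreover have "inj_on p C" using p unfolding C_def bij_betw_def by (auto intro: inj_on_subset)
    ultimately have "card C = card (B i)" using card_image by metis
    moreover have "card (A i \<union> C) + card (A i \<inter> C) = card (A i) + card C"
      using card_Un_Int[OF fin] by simp
    moreover have "x \<in> A i \<inter> C" using i x unfolding C_def by blast
    then have "0 < card (A i \<inter> C)" using fin by (auto simp: card_gt_0_iff)
    ultimately have "card (A i \<union> C) < card X" using AB[OF i(1)] n by linarith
    moreover have "A i \<union> C \<subseteq> X" using AB[OF i(1)] unfolding C_def by blast
    ultimately have "A i \<union> C \<subset> X" by blast
    then obtain z where z: "z \<in> X" "z \<notin> A i" "p z \<notin> B i" unfolding C_def by blast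
    define q where "q = p \<circ> transpose x z"
    have "bij_betw q X Y"
      unfolding q_def using p permutes_imp_bij[OF permutes_swap_id[OF x(1) z(1)]] by (rule bij_betw_trans[rotated])
    have "{x, p z} \<in> E" using edge[OF x(1) pY[OF z(1)]] z i uniqA by blast
    moreover have "{z, p x} \<in> E" using edge[OF z(1) pY[OF x(1)]] z i uniqB by blast
    ultimately have "bad q \<subset> bad p"
      using x unfolding bad_def q_def by (auto simp: transpose_def split: if_splits)
    then have "card (bad q) < card (bad p)" using psubset_card_mono finbad by blast
    then show False using least[OF \<open>bij_betw q X Y\<close>] by simp
  qed
  then have "matching_map p" using p unfolding matching_map_def bad_def by blast
  then show "\<exists>p. matching_map p" by blast
qed

text \<open>As all other edges are forbidden, every perfect matching stays inside the two bicliques.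
  Of any three vertices of \<open>X\<close>, two lie in the same part, and these are joined by arcs
  in both directions.\<close>

lemma two_bicliques:
  assumes X: "X = X1 \<union> X2" "X1 \<inter> X2 = {}" and Y: "Y = Y1 \<union> Y2" "Y1 \<inter> Y2 = {}"
    and ne: "X1 \<noteq> {}" "X2 \<noteq> {}" and cards: "card X1 = card Y1" "card X2 = card Y2"
    and sub: "biclique_edges X1 Y1 \<subseteq> E" "biclique_edges X2 Y2 \<subseteq> E"
    and forb: "\<And>e. e \<in> E - (biclique_edges X1 Y1 \<union> biclique_edges X2 Y2) \<Longrightarrow> forbidden_edge (X \<union> Y) E e"
  shows "\<exists>p. matching_map p" "\<exists>x\<in>X. \<exists>y\<in>Y. {x, y} \<notin> E" "acyclic_triple_free"
proof -
  have E1: "{x, y} \<in> E" if "x \<in> X1" "y \<in> Y1" for x y using sub that unfolding biclique_edges_def by blast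
  have E2: "{x, y} \<in> E" if "x \<in> X2" "y \<in> Y2" for x y using sub that unfolding biclique_edges_def by blast
  have fin: "finite X1" "finite X2" "finite Y1" "finite Y2" using finite_X finite_Y X Y by auto
  have inside: "x \<in> X1 \<and> p x \<in> Y1 \<or> x \<in> X2 \<and> p x \<in> Y2" if p: "matching_map p" and x: "x \<in> X" for p x
  proof -
    have "\<not> forbidden_edge (X \<union> Y) E {x, p x}"
      using forbidden_edge_iff[OF x matching_map_in[OF p x]] p by blast
    then have "{x, p x} \<in> biclique_edges X1 Y1 \<union> biclique_edges X2 Y2"
      using forb matching_map_edge[OF p x] by blast
    then consider x' y' where "x' \<in> X1" "y' \<in> Y1" "{x, p x} = {x', y'}"
      | x' y' where "x' \<in> X2" "y' \<in> Y2" "{x, p x} = {x', y'}" unfolding biclique_edges_def by blast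
    then show ?thesis
      using edge_eq_iff[OF x _ matching_map_in[OF p x]] X Y by cases auto
  qed
  obtain f g where fg: "bij_betw f X1 Y1" "bij_betw g X2 Y2"
    using finite_same_card_bij fin cards by metis
  define p where "p x = (if x \<in> X1 then f x else g x)" for x
  have "bij_betw p X1 Y1" using fg(1) by (rule bij_betw_cong[THEN iffD1, rotated]) (simp add: p_def)
  moreover have "bij_betw p X2 Y2"
    using fg(2) by (rule bij_betw_cong[THEN iffD1, rotated]) (use X in \<open>auto simp: p_def\<close>)
  ultimately have bij: "bij_betw p X Y" unfolding X Y using Y(2) by (rule bij_betw_combine)
  have p: "matching_map p"
    unfolding matching_map_def
    using bij E1 E2 \<open>bij_betw p X1 Y1\<close> \<open>bij_betw p X2 Y2\<close> X by (auto dest: bij_betwE)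
  then show "\<exists>p. matching_map p" by blast
  obtain a b where ab: "a \<in> X1" "b \<in> X2" using ne by blast
  have abX: "a \<in> X" "b \<in> X" "a \<noteq> b" using ab X by auto
  \<comment> \<open>Otherwise the rotation would produce a perfect matching that leaves the two
    bicliques.\<close>
  have "\<not> ({a, p b} \<in> E \<and> {b, p a} \<in> E)"
  proof
    assume "{a, p b} \<in> E \<and> {b, p a} \<in> E"
    then have "matching_map (p \<circ> transpose a b)" using rotate2[OF p abX(1,2)] by blast
    from inside[OF this abX(1)] inside[OF p abX(2)] show False using ab X Y by auto
  qed
  then show "\<exists>x\<in>X. \<exists>y\<in>Y. {x, y} \<notin> E" using abX matching_map_in[OF p] by blast
  show "acyclic_triple_free"
    unfolding acyclic_triple_free_def
  proof (intro allI impI ballI)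
    fix q a b c
    assume q: "matching_map q" and X': "a \<in> X" "b \<in> X" "c \<in> X"
    show "{a, q b} \<in> E \<or> {a, q c} \<in> E \<or> {b, q c} \<in> E"
      using inside[OF q X'(1)] inside[OF q X'(2)] inside[OF q X'(3)] E1 E2 by blast
  qed
qed

end

section \<open>Returning to unoriented graphs\<close>

text \<open>A biclique with nonempty parts is connected, so its 2-colouring is determined up to
  swapping the colours.\<close>

lemma bipartition_biclique_sides:
  assumes "bipartition X Y E" "biclique_edges P Q \<subseteq> E" "P \<noteq> {}" "Q \<noteq> {}"
  shows "P \<subseteq> X \<and> Q \<subseteq> Y \<or> P \<subseteq> Y \<and> Q \<subseteq> X"
proof -
  interpret bipartition X Y E by fact
  have pq: "p \<in> X \<and> q \<in> Y \<or> p \<in> Y \<and> q \<in> X" if "p \<in> P" "q \<in> Q" for p q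
  proof -
    have "{p, q} \<in> E" using assms(2) that unfolding biclique_edges_def by blast
    then obtain x y where "x \<in> X" "y \<in> Y" "{p, q} = {x, y}" by (elim edgeE)
    then show ?thesis by (auto simp: doubleton_eq_iff)
  qed
  obtain p q where "p \<in> P" "q \<in> Q" using assms by blast
  then show ?thesis using pq disjoint_XY by blast
qed

lemma bipartite_graph_bipartition:
  assumes "bipartite_graph V E"
  obtains X Y where "bipartition X Y E" "V = X \<union> Y"
proof -
  obtain X Y where XY: "X \<union> Y = V" "X \<inter> Y = {}" "\<forall>e\<in>E. \<exists>x\<in>X. \<exists>y\<in>Y. e = {x, y}"
    and "finite V" using assms unfolding bipartite_graph_def finite_simple_graph_def by blast
  have "bipartition X Y E"
  proof
    show "finite X" "finite Y" using XY(1) \<open>finite V\<close> by auto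
    show "E \<subseteq> biclique_edges X Y" unfolding biclique_edges_def using XY(3) by blast
  qed (fact XY(2))
  then show ?thesis using that XY(1) by blast
qed

lemma G1_forcing_number:
  assumes "(V, E) \<in> G1 n" "2 \<le> n"
  shows "(\<exists>M. perfect_matching V E M) \<and> forcing_number V E = n - 2"
proof -
  obtain X Y A B and t :: nat where fin: "finite X" "finite Y" and dis: "X \<inter> Y = {}"
    and n: "card X = n" "card Y = n" and t: "1 \<le> t"
    and AB: "\<forall>i<t. A i \<subseteq> X \<and> A i \<noteq> {} \<and> B i \<subseteq> Y \<and> B i \<noteq> {} \<and> card (A i) + card (B i) \<le> n"
    and dAB: "disjoint_family_on (\<lambda>i. A i \<union> B i) {..<t}" and V: "V = X \<union> Y"
    and E: "E = biclique_edges X Y - (\<Union>i<t. biclique_edges (A i) (B i))"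
    using assms(1) unfolding G1_def by blast
  interpret bipartition X Y E using fin dis E by unfold_locales auto
  note props = removed_bicliques[OF n t _ dAB E] AB
  obtain p where p: "matching_map p" using props by blast
  show ?thesis
    using forcing_number_eq_iff_acyclic_triple_free[OF p n(1) assms(2)] props
      ex_perfect_matching_iff p V by blast
qed

lemma G2_forcing_number:
  assumes "(V, E) \<in> G2 n" "2 \<le> n"
  shows "(\<exists>M. perfect_matching V E M) \<and> forcing_number V E = n - 2"
proof -
  obtain a b X1 Y1 X2 Y2 where bip: "bipartite_graph V E" and ab: "1 \<le> a" "1 \<le> b" "a + b = n"
    and cards: "card X1 = a" "card Y1 = a" "card X2 = b" "card Y2 = b"
    and dis: "X1 \<inter> Y1 = {}" "X2 \<inter> Y2 = {}" "(X1 \<union> Y1) \<inter> (X2 \<union> Y2) = {}"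
    and V: "V = (X1 \<union> Y1) \<union> (X2 \<union> Y2)"
    and sub: "biclique_edges X1 Y1 \<subseteq> E" "biclique_edges X2 Y2 \<subseteq> E"
    and forb: "\<forall>e \<in> E - (biclique_edges X1 Y1 \<union> biclique_edges X2 Y2).
      (\<exists>x \<in> X1 \<union> Y1. \<exists>y \<in> X2 \<union> Y2. e = {x, y}) \<and> forbidden_edge V E e"
    using assms(1) unfolding G2_def mem_Collect_eq case_prod_conv by (elim conjE exE) (rule that)
  obtain X Y where XY: "bipartition X Y E" "V = X \<union> Y" using bipartite_graph_bipartition[OF bip] by blast
  interpret bipartition X Y E by (fact XY(1))
  have ne: "X1 \<noteq> {}" "Y1 \<noteq> {}" "X2 \<noteq> {}" "Y2 \<noteq> {}" using cards ab by auto
  \<comment> \<open>The definition of \<open>G2\<close> does not tell which of \<open>X1\<close>,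
    \<open>Y1\<close> and which of \<open>X2\<close>, \<open>Y2\<close> lie in \<open>X\<close>. The
    equations of unordered pairs let one argument cover all four orientations.\<close>
  have oriented: ?thesis
    if s: "P1 \<subseteq> X" "Q1 \<subseteq> Y" "P2 \<subseteq> X" "Q2 \<subseteq> Y"
      and PQ: "{P1, Q1} = {X1, Y1}" "{P2, Q2} = {X2, Y2}" for P1 Q1 P2 Q2
  proof -
    have un: "P1 \<union> Q1 = X1 \<union> Y1" "P2 \<union> Q2 = X2 \<union> Y2" using PQ by (auto simp: doubleton_eq_iff)
    have cPQ: "card P1 = a" "card Q1 = a" "card P2 = b" "card Q2 = b" "P1 \<noteq> {}" "P2 \<noteq> {}"
      using PQ cards ne by (auto simp: doubleton_eq_iff)
    have bic: "biclique_edges P1 Q1 = biclique_edges X1 Y1" "biclique_edges P2 Q2 = biclique_edges X2 Y2"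
      using PQ biclique_edges_commute by (auto simp: doubleton_eq_iff)
    have X: "X = P1 \<union> P2" and Y: "Y = Q1 \<union> Q2"
      using s un V XY(2) disjoint_XY by blast+
    have d: "P1 \<inter> P2 = {}" "Q1 \<inter> Q2 = {}" using un dis(3) by blast+
    have f: "forbidden_edge (X \<union> Y) E e"
      if "e \<in> E - (biclique_edges P1 Q1 \<union> biclique_edges P2 Q2)" for e
      using that forb bic XY(2) by simp
    have bE: "biclique_edges P1 Q1 \<subseteq> E" "biclique_edges P2 Q2 \<subseteq> E" using sub bic by auto
    have ceq: "card P1 = card Q1" "card P2 = card Q2" using cPQ by auto
    note props = two_bicliques[OF X d(1) Y d(2) cPQ(5,6) ceq bE f]
    obtain p where p: "matching_map p" using props(1) by blast
    have fin: "finite P1" "finite P2" using X finite_X by auto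
    have "card X = n" using card_Un_disjoint[OF fin d(1)] X cPQ ab by simp
    from forcing_number_eq_iff_acyclic_triple_free[OF p this assms(2)] show ?thesis
      using props ex_perfect_matching_iff p XY(2) by blast
  qed
  show ?thesis
    using bipartition_biclique_sides[OF XY(1) sub(1) ne(1,2)]
      bipartition_biclique_sides[OF XY(1) sub(2) ne(3,4)]
      oriented[of X1 Y1 X2 Y2] oriented[of Y1 X1 X2 Y2] oriented[of X1 Y1 Y2 X2] oriented[of Y1 X1 Y2 X2]
    by (auto simp: insert_commute)
qed

theorem theorem4p6:
  fixes V :: "'a set" and E :: "'a set set" and n :: nat
  assumes "bipartite_graph V E" and "card V = 2 * n" and "n \<ge> 2"
  shows "((\<exists>M. perfect_matching V E M) \<and> forcing_number V E = n - 2) \<longleftrightarrow>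
         ((V, E) \<in> G1 n \<or> (V, E) \<in> G2 n)"
proof
  assume L: "(\<exists>M. perfect_matching V E M) \<and> forcing_number V E = n - 2"
  obtain X Y where XY: "bipartition X Y E" "V = X \<union> Y"
    using bipartite_graph_bipartition[OF assms(1)] by blast
  interpret bipartition X Y E by (fact XY(1))
  obtain p where p: "matching_map p" using L XY(2) ex_perfect_matching_iff by blast
  have n: "card X = n"
    using assms(2) card_Un_disjoint[OF finite_X finite_Y disjoint_XY] matching_map_card[OF p] XY(2) by simp
  have atf: "acyclic_triple_free" and nonedge: "\<exists>x\<in>X. \<exists>y\<in>Y. {x, y} \<notin> E"
    using forcing_number_eq_iff_acyclic_triple_free[OF p n assms(3)] L XY(2) by auto
  show "(V, E) \<in> G1 n \<or> (V, E) \<in> G2 n"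
  proof (cases "\<exists>x\<in>X. \<exists>y\<in>Y. {x, y} \<in> E \<and> (\<forall>q. matching_map q \<longrightarrow> q x \<noteq> y)")
    case True
    then show ?thesis using mem_G2I[OF atf p n] XY(2) by blast
  next
    case False
    \<comment> \<open>If \<open>{x', y'}\<close> were an edge, the case assumption would give a
      matching map through it, and \<open>acyclic_triple_free_forbidden\<close> would apply to that
      map.\<close>
    have "{x', y'} \<notin> E"
      if "x \<in> X" "x' \<in> X" "y \<in> Y" "y' \<in> Y" "{x, y} \<notin> E" "{x, y'} \<notin> E" "{x', y} \<notin> E" for x x' y y'
      using False that acyclic_triple_free_forbidden[OF atf, of _ x x' y] by blast
    then show ?thesis using mem_G1I[OF p n nonedge] XY(2) by blast
  qed
next
  assume "(V, E) \<in> G1 n \<or> (V, E) \<in> G2 n"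
  then show "(\<exists>M. perfect_matching V E M) \<and> forcing_number V E = n - 2"
    using G1_forcing_number G2_forcing_number assms(3) by blast
qed

end
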